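(* Let $k$ be a field with $\mathrm{char}(k)\neq 2$, let $G=C_2\times C_2=\{e,\sigma,\tau,\rho\}$, and let $\phi:G\times G\times G\to k^*$ be a happy normalized $3$-cocycle. Put $\varepsilon_x=\phi(x,x,x)$ for $x\in\{\sigma,\tau,\rho\}$, $p=\varepsilon_\sigma\varepsilon_\tau\varepsilon_\rho$, $a=\phi(\tau,\sigma,\sigma)$ and $b=\phi(\sigma,\tau,\sigma)$. Then $\phi$ is completely determined by $\varepsilon_\sigma,\varepsilon_\tau,\varepsilon_\rho,a,b$. More precisely, $$\begin{aligned} a&=\phi(\tau,\sigma,\sigma)=p\,\phi(\sigma,\tau,\tau)=p\,\phi(\tau,\tau,\sigma)^{-1}=\phi(\sigma,\sigma,\tau)^{-1}\\ &=\varepsilon_\sigma\phi(\rho,\sigma,\sigma)=p\,\varepsilon_\sigma\phi(\sigma,\rho,\rho)=\varepsilon_\sigma\phi(\sigma,\sigma,\rho)^{-1}=p\,\varepsilon_\sigma\phi(\rho,\rho,\sigma)^{-1}\\ &=p\,\varepsilon_\tau\phi(\rho,\tau,\tau)=\varepsilon_\tau\phi(\tau,\rho,\rho)=p\,\varepsilon_\tau\phi(\tau,\tau,\rho)^{-1}=\varepsilon_\tau\phi(\rho,\rho,\tau)^{-1},\\ b&=\phi(\sigma,\tau,\sigma)=p\,\varepsilon_\sigma\phi(\rho,\sigma,\rho)=p\,\varepsilon_\tau\phi(\tau,\rho,\tau)\\ &=p\,\phi(\tau,\sigma,\tau)^{-1}=\varepsilon_\sigma\phi(\sigma,\rho,\sigma)^{-1}=\varepsilon_\tau\phi(\rho,\tau,\rho)^{-1}.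 \end{aligned}$$
   Context: $C_2\times C_2=\{e,\sigma,\tau,\rho\}$ is the Klein group, with $\sigma\tau=\tau\sigma=\rho$, $\sigma^2=\tau^2=e$. $k^*=k\setminus\{0\}$. A $3$-cocycle on a group $G$ (coefficients in $k^*$, trivial action) is a map $\phi:G^3\to k^*$ with $\phi(y,z,t)\phi(x,yz,t)\phi(x,y,z)=\phi(xy,z,t)\phi(x,y,zt)$ for all $x,y,z,t\in G$. It is normalized if $\phi(x,e,z)=1$ for all $x,z$ (then $\phi$ equals $1$ as soon as one entry is $e$). For a normalized $3$-cocycle $\phi$ on $C_2\times C_2$ put $p=\phi(\sigma,\tau,\rho)\phi(\tau,\rho,\sigma)\phi(\rho,\sigma,\tau)$; one has $p=\varepsilon_\sigma\varepsilon_\tau\varepsilon_\rho=\pm1$ where $\varepsilon_x=\phi(x,x,x)\in\{\pm1\}$. $\phi$ is called happy if $\phi(x,y,z)=p$ whenever $x,y,z$ are pairwise distinct elements of $\{\sigma,\tau,\rho\}$. *)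

theory Defs
  imports "HOL-Algebra.Algebra"
begin

text \<open>
  The group is an object of HOL-Algebra; the coefficients lie in a type-class field \<open>'k\<close>,
  with \<open>k\<^sup>*\<close> its set of nonzero elements.  A function on a group is only constrained on
  the carrier.
\<close>

locale klein_four = group G for G (structure) +
  fixes \<sigma> \<tau> \<rho> :: 'a
  assumes carrier_eq: "carrier G = {\<one>, \<sigma>, \<tau>, \<rho>}"
    and distinct_elements: "distinct [\<one>, \<sigma>, \<tau>, \<rho>]"
    and sigma_tau: "\<sigma> \<otimes> \<tau> = \<rho>"
    and tau_sigma: "\<tau> \<otimes> \<sigma> = \<rho>"
    and sigma_sq: "\<sigma> \<otimes> \<sigma> = \<one>"
    and tau_sq: "\<tau> \<otimes> \<tau> = \<one>"

lemma klein_four_C2_C2: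
  "klein_four (integer_mod_group 2 \<times>\<times> integer_mod_group 2) (1, 0) (0, 1) (1, 1)"
proof -
  have c: "{0..<2::int} = {0, 1}" by auto
  show ?thesis
    by (intro klein_four.intro klein_four_axioms.intro DirProd_group group_integer_mod_group)
      (auto simp: DirProd_def carrier_integer_mod_group mult_integer_mod_group c)
qed

definition three_cocycle :: "('a, 'm) monoid_scheme \<Rightarrow> ('a \<Rightarrow> 'a \<Rightarrow> 'a \<Rightarrow> 'k::field) \<Rightarrow> bool"
  where "three_cocycle G \<phi> \<longleftrightarrow>
    (\<forall>x\<in>carrier G. \<forall>y\<in>carrier G. \<forall>z\<in>carrier G. \<phi> x y z \<noteq> 0) \<and>
    (\<forall>x\<in>carrier G. \<forall>y\<in>carrier G. \<forall>z\<in>carrier G. \<forall>t\<in>carrier G.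
      \<phi> y z t * \<phi> x (y \<otimes>\<^bsub>G\<^esub> z) t * \<phi> x y z = \<phi> (x \<otimes>\<^bsub>G\<^esub> y) z t * \<phi> x y (z \<otimes>\<^bsub>G\<^esub> t))"

definition normalized_three_cocycle ::
    "('a, 'm) monoid_scheme \<Rightarrow> ('a \<Rightarrow> 'a \<Rightarrow> 'a \<Rightarrow> 'k::field) \<Rightarrow> bool"
  where "normalized_three_cocycle G \<phi> \<longleftrightarrow>
    three_cocycle G \<phi> \<and> (\<forall>x\<in>carrier G. \<forall>z\<in>carrier G. \<phi> x \<one>\<^bsub>G\<^esub> z = 1)"

text \<open>
  For a normalized cocycle the product below also equals
  \<open>\<phi> \<sigma> \<sigma> \<sigma> * \<phi> \<tau> \<tau> \<tau> * \<phi> \<rho> \<rho> \<rho>\<close> and is \<open>1\<close> or \<open>-1\<close>; neither is part of the definition.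
\<close>

definition happy :: "'a \<Rightarrow> 'a \<Rightarrow> 'a \<Rightarrow> ('a \<Rightarrow> 'a \<Rightarrow> 'a \<Rightarrow> 'k::field) \<Rightarrow> bool"
  where "happy \<sigma> \<tau> \<rho> \<phi> \<longleftrightarrow>
    (\<forall>x\<in>{\<sigma>, \<tau>, \<rho>}. \<forall>y\<in>{\<sigma>, \<tau>, \<rho>}. \<forall>z\<in>{\<sigma>, \<tau>, \<rho>}.
      x \<noteq> y \<and> y \<noteq> z \<and> x \<noteq> z \<longrightarrow> \<phi> x y z = \<phi> \<sigma> \<tau> \<rho> * \<phi> \<tau> \<rho> \<sigma> * \<phi> \<rho> \<sigma> \<tau>)"

end

theory Submission
  imports Defs
begin

text \<open>
  Each choice of an ordered pair \<open>(x, y)\<close> of distinct involutions, with \<open>z\<close> the third one, gives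
  three unknown cocycle values with a repeated entry: \<open>\<phi> y x x\<close>, \<open>\<phi> x x y\<close> and \<open>\<phi> x y x\<close>.
  The six ordered pairs form a hexagon whose edges are the two moves \<open>(x, y) \<mapsto> (y, x)\<close> and
  \<open>(x, y) \<mapsto> (x, z)\<close>.  The cocycle equation at suitable quadruples says how the values change
  along an edge: with \<open>q\<close> the common value of \<open>\<phi>\<close> at pairwise distinct involutions,
  the first move multiplies \<open>\<phi> y x x\<close> by \<open>q\<close> and the second one by \<open>\<phi> x x x\<close>, while
  \<open>\<phi> x y x\<close> is inverted and multiplied by the same factor; finally \<open>\<phi> x x y\<close> is the inverse of
  \<open>\<phi> y x x\<close>.  So walking around the hexagon from \<open>(\<sigma>, \<tau>)\<close> expresses everything through
  \<open>a\<close>, \<open>b\<close>, \<open>q\<close> and the signs (lemmas \<open>swap_outer_pair\<close>, \<open>change_partner\<close>, \<open>swap_sandwich\<close>,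
  \<open>change_sandwich\<close>, \<open>repeated_left\<close>).

  Two facts about \<open>q\<close> make this close up.  Happiness gives \<open>q = q\<^sup>3\<close>, so \<open>q\<^sup>2 = 1\<close>.  And the
  product of the factors around the whole hexagon must be trivial, which forces \<open>q\<close> to be the
  product of the three signs.  Since the moves generate all permutations of \<open>\<sigma>, \<tau>, \<rho>\<close>, each
  relation is needed only for one ordering; the others come from reinterpreting the locale.
\<close>

section \<open>Permuting the involutions\<close>

context klein_four
begin

lemma involutions_closed [simp]: "\<sigma> \<in> carrier G" "\<tau> \<in> carrier G" "\<rho> \<in> carrier G"
  by (auto simp: carrier_eq)

lemma mult_table [simp]:
  "\<sigma> \<otimes> \<sigma> = \<one>" "\<tau> \<otimes> \<tau> = \<one>" "\<rho> \<otimes> \<rho> = \<one>"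
  "\<sigma> \<otimes> \<tau> = \<rho>" "\<tau> \<otimes> \<sigma> = \<rho>" "\<sigma> \<otimes> \<rho> = \<tau>"
  "\<rho> \<otimes> \<sigma> = \<tau>" "\<tau> \<otimes> \<rho> = \<sigma>" "\<rho> \<otimes> \<tau> = \<sigma>"
proof -
  show sr: "\<sigma> \<otimes> \<rho> = \<tau>"
    using m_assoc[of \<sigma> \<sigma> \<tau>] by (simp add: sigma_tau sigma_sq)
  show tr: "\<tau> \<otimes> \<rho> = \<sigma>"
    using m_assoc[of \<tau> \<tau> \<sigma>] by (simp add: tau_sigma tau_sq)
  show "\<rho> \<otimes> \<sigma> = \<tau>"
    using m_assoc[of \<tau> \<sigma> \<sigma>] by (simp add: tau_sigma sigma_sq)
  show "\<rho> \<otimes> \<tau> = \<sigma>"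
    using m_assoc[of \<sigma> \<tau> \<tau>] by (simp add: sigma_tau tau_sq)
  show "\<rho> \<otimes> \<rho> = \<one>"
    using m_assoc[of \<sigma> \<tau> \<rho>] by (simp add: sigma_tau tr sigma_sq)
qed (simp_all add: sigma_tau tau_sigma sigma_sq tau_sq)

lemma klein_four_swap_first_two: "klein_four G \<tau> \<sigma> \<rho>"
  by unfold_locales (use carrier_eq distinct_elements in auto)

lemma klein_four_swap_last_two: "klein_four G \<sigma> \<rho> \<tau>"
  by unfold_locales (use carrier_eq distinct_elements in auto)

end

locale happy_klein_cocycle = klein_four G \<sigma> \<tau> \<rho>
  for G :: "('g, 'm) monoid_scheme" (structure) and \<sigma> \<tau> \<rho> +
  fixes \<phi> :: "'g \<Rightarrow> 'g \<Rightarrow> 'g \<Rightarrow> 'k::field"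
  assumes normalized_cocycle: "normalized_three_cocycle G \<phi>"
    and happy_cocycle: "happy \<sigma> \<tau> \<rho> \<phi>"
begin

text \<open>
  The product that defines \<open>p\<close> runs over the cyclic orderings of one orientation; happiness
  makes it the same for the other orientation, so happiness does not depend on the
  order of the three involutions.
\<close>

lemma happy_values:
  assumes "{x, y, z} = {\<sigma>, \<tau>, \<rho>}"
  shows "\<phi> x y z = \<phi> \<sigma> \<tau> \<rho>"
proof -
  have d: "\<sigma> \<noteq> \<tau>" "\<sigma> \<noteq> \<rho>" "\<tau> \<noteq> \<rho>"
    using distinct_elements by auto
  have "x \<in> {\<sigma>, \<tau>, \<rho>}" "y \<in> {\<sigma>, \<tau>, \<rho>}" "z \<in> {\<sigma>, \<tau>, \<rho>}"
    unfolding assms[symmetric] by simp_all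
  moreover have "x \<noteq> y \<and> y \<noteq> z \<and> x \<noteq> z"
    using assms d by (auto simp: set_eq_iff; metis)
  ultimately have "\<phi> x y z = \<phi> \<sigma> \<tau> \<rho> * \<phi> \<tau> \<rho> \<sigma> * \<phi> \<rho> \<sigma> \<tau>"
    using happy_cocycle unfolding happy_def by blast
  moreover have "\<phi> \<sigma> \<tau> \<rho> = \<phi> \<sigma> \<tau> \<rho> * \<phi> \<tau> \<rho> \<sigma> * \<phi> \<rho> \<sigma> \<tau>"
    using happy_cocycle d unfolding happy_def by blast
  ultimately show ?thesis by simp
qed

lemma distinct_values:
  "\<phi> \<sigma> \<rho> \<tau> = \<phi> \<sigma> \<tau> \<rho>" "\<phi> \<tau> \<sigma> \<rho> = \<phi> \<sigma> \<tau> \<rho>" "\<phi> \<tau> \<rho> \<sigma> = \<phi> \<sigma> \<tau> \<rho>"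
  "\<phi> \<rho> \<sigma> \<tau> = \<phi> \<sigma> \<tau> \<rho>" "\<phi> \<rho> \<tau> \<sigma> = \<phi> \<sigma> \<tau> \<rho>"
  by (rule happy_values; auto)+

lemma happy_product: "\<phi> \<sigma> \<tau> \<rho> = \<phi> \<sigma> \<tau> \<rho> * \<phi> \<sigma> \<tau> \<rho> * \<phi> \<sigma> \<tau> \<rho>"
proof -
  have "\<phi> \<sigma> \<tau> \<rho> = \<phi> \<sigma> \<tau> \<rho> * \<phi> \<tau> \<rho> \<sigma> * \<phi> \<rho> \<sigma> \<tau>"
    using happy_cocycle distinct_elements unfolding happy_def by auto
  then show ?thesis by (simp add: distinct_values)
qed

lemma happy_permuted:
  assumes "{x, y, z} = {\<sigma>, \<tau>, \<rho>}"
  shows "happy x y z \<phi>"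
proof -
  have "{u, v, w} = {\<sigma>, \<tau>, \<rho>}"
    if "u \<in> {x, y, z}" "v \<in> {x, y, z}" "w \<in> {x, y, z}" "u \<noteq> v \<and> v \<noteq> w \<and> u \<noteq> w" for u v w
    using that unfolding assms by auto
  moreover have "{y, z, x} = {\<sigma>, \<tau>, \<rho>}" "{z, x, y} = {\<sigma>, \<tau>, \<rho>}"
    using assms by (simp_all add: insert_commute)
  ultimately show ?thesis
    using happy_product unfolding happy_def by (metis assms happy_values)
qed

lemma swap_first_two: "happy_klein_cocycle G \<tau> \<sigma> \<rho> \<phi>"
  using klein_four_swap_first_two normalized_cocycle happy_permuted[of \<tau> \<sigma> \<rho>]
  by (simp add: happy_klein_cocycle_def happy_klein_cocycle_axioms_def insert_commute)

lemma swap_last_two: "happy_klein_cocycle G \<sigma> \<rho> \<tau> \<phi>"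
  using klein_four_swap_last_two normalized_cocycle happy_permuted[of \<sigma> \<rho> \<tau>]
  by (simp add: happy_klein_cocycle_def happy_klein_cocycle_axioms_def insert_commute)

section \<open>Relations along the edges of the hexagon\<close>

lemma cocycle_equation:
  assumes "x \<in> carrier G" "y \<in> carrier G" "z \<in> carrier G" "t \<in> carrier G"
  shows "\<phi> y z t * \<phi> x (y \<otimes> z) t * \<phi> x y z = \<phi> (x \<otimes> y) z t * \<phi> x y (z \<otimes> t)"
  using normalized_cocycle assms
  unfolding normalized_three_cocycle_def three_cocycle_def by blast

lemma nonzero:
  assumes "x \<in> carrier G" "y \<in> carrier G" "z \<in> carrier G"
  shows "\<phi> x y z \<noteq> 0"
  using normalized_cocycle assms
  unfolding normalized_three_cocycle_def three_cocycle_def by blast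

lemma one_middle:
  assumes "x \<in> carrier G" "z \<in> carrier G"
  shows "\<phi> x \<one> z = 1"
  using normalized_cocycle assms unfolding normalized_three_cocycle_def by blast

text \<open>
  In the cocycle equation at \<open>(\<one>, \<one>, y, z)\<close> and at \<open>(x, y, \<one>, \<one>)\<close> all but one factor cancels
  or is covered by normalization in the middle entry.
\<close>

lemma one_left:
  assumes "y \<in> carrier G" "z \<in> carrier G"
  shows "\<phi> \<one> y z = 1"
  using cocycle_equation[of \<one> \<one> y z] nonzero[of \<one> y z] assms by (simp add: one_middle)

lemma one_right:
  assumes "x \<in> carrier G" "y \<in> carrier G"
  shows "\<phi> x y \<one> = 1"
  using cocycle_equation[of x y \<one> \<one>] nonzero[of x y \<one>] assms by (simp add: one_middle)

lemmas one_entry = one_left one_middle one_right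

lemma sign_square: "\<phi> \<sigma> \<sigma> \<sigma> * \<phi> \<sigma> \<sigma> \<sigma> = 1"
  using cocycle_equation[of \<sigma> \<sigma> \<sigma> \<sigma>] by (simp add: one_entry)

lemma distinct_square: "\<phi> \<sigma> \<tau> \<rho> * \<phi> \<sigma> \<tau> \<rho> = 1"
  using happy_product nonzero[of \<sigma> \<tau> \<rho>] by simp

text \<open>
  The quadruple \<open>(\<tau>, \<sigma>, \<sigma>, \<tau>)\<close> makes the middle product trivial and leaves on the other side
  two values at pairwise distinct involutions, whose product is \<open>q\<^sup>2 = 1\<close>.
\<close>

lemma repeated_left: "\<phi> \<sigma> \<sigma> \<tau> = inverse (\<phi> \<tau> \<sigma> \<sigma>)"
proof -
  have "\<phi> \<sigma> \<sigma> \<tau> * \<phi> \<tau> \<sigma> \<sigma> = \<phi> \<rho> \<sigma> \<tau> * \<phi> \<tau> \<sigma> \<rho>"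
    using cocycle_equation[of \<tau> \<sigma> \<sigma> \<tau>] by (simp add: one_entry)
  then show ?thesis
    by (simp add: distinct_values distinct_square inverse_unique mult.commute)
qed

lemma swap_outer_pair: "\<phi> \<sigma> \<tau> \<tau> = \<phi> \<sigma> \<tau> \<rho> * \<phi> \<tau> \<sigma> \<sigma>"
proof -
  have "\<phi> \<sigma> \<tau> \<tau> * \<phi> \<sigma> \<rho> \<tau> * \<phi> \<sigma> \<sigma> \<tau> = 1"
    using cocycle_equation[of \<sigma> \<sigma> \<tau> \<tau>] by (simp add: one_entry)
  then have "\<phi> \<sigma> \<tau> \<tau> * \<phi> \<sigma> \<tau> \<rho> = \<phi> \<tau> \<sigma> \<sigma>"
    using nonzero[of \<tau> \<sigma> \<sigma>] by (simp add: distinct_values repeated_left field_simps)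
  then have "\<phi> \<sigma> \<tau> \<tau> * (\<phi> \<sigma> \<tau> \<rho> * \<phi> \<sigma> \<tau> \<rho>) = \<phi> \<tau> \<sigma> \<sigma> * \<phi> \<sigma> \<tau> \<rho>"
    by (simp flip: mult.assoc)
  then show ?thesis
    by (simp add: distinct_square mult.commute)
qed

lemma change_partner: "\<phi> \<rho> \<sigma> \<sigma> = \<phi> \<sigma> \<sigma> \<sigma> * \<phi> \<tau> \<sigma> \<sigma>"
  using cocycle_equation[of \<tau> \<sigma> \<sigma> \<sigma>] by (simp add: one_entry)

lemma swap_sandwich: "\<phi> \<tau> \<sigma> \<tau> = \<phi> \<sigma> \<tau> \<rho> * inverse (\<phi> \<sigma> \<tau> \<sigma>)"
proof -
  have "\<phi> \<tau> \<sigma> \<tau> * \<phi> \<sigma> \<rho> \<tau> * \<phi> \<sigma> \<tau> \<sigma> = \<phi> \<rho> \<sigma> \<tau> * \<phi> \<sigma> \<tau> \<rho>"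
    using cocycle_equation[of \<sigma> \<tau> \<sigma> \<tau>] by simp
  then show ?thesis
    using nonzero[of \<sigma> \<tau> \<sigma>] nonzero[of \<sigma> \<tau> \<rho>] by (simp add: distinct_values field_simps)
qed

text \<open>
  In the equation at \<open>(\<sigma>, \<tau>, \<sigma>, \<sigma>)\<close> the values \<open>\<phi> \<tau> \<sigma> \<sigma>\<close> and \<open>\<phi> \<rho> \<sigma> \<sigma>\<close> occur on opposite sides;
  they lie at the ends of one edge of the hexagon, so their ratio is the sign \<open>\<phi> \<sigma> \<sigma> \<sigma>\<close>.
\<close>

lemma change_sandwich: "\<phi> \<sigma> \<rho> \<sigma> = \<phi> \<sigma> \<sigma> \<sigma> * inverse (\<phi> \<sigma> \<tau> \<sigma>)"
proof -
  have "\<phi> \<tau> \<sigma> \<sigma> * \<phi> \<sigma> \<rho> \<sigma> * \<phi> \<sigma> \<tau> \<sigma> = \<phi> \<rho> \<sigma> \<sigma>"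
    using cocycle_equation[of \<sigma> \<tau> \<sigma> \<sigma>] by (simp add: one_entry)
  then show ?thesis
    using nonzero[of \<sigma> \<tau> \<sigma>] nonzero[of \<tau> \<sigma> \<sigma>] by (simp add: change_partner field_simps)
qed

end

section \<open>Walking around the hexagon\<close>

context happy_klein_cocycle
begin

text \<open>
  The prefix of each interpretation is the ordered pair that takes the place of \<open>(\<sigma>, \<tau>)\<close>.
\<close>

interpretation ts: happy_klein_cocycle G \<tau> \<sigma> \<rho> \<phi> by (rule swap_first_two)
interpretation sr: happy_klein_cocycle G \<sigma> \<rho> \<tau> \<phi> by (rule swap_last_two)
interpretation rs: happy_klein_cocycle G \<rho> \<sigma> \<tau> \<phi> by (rule sr.swap_first_two)
interpretation tr: happy_klein_cocycle G \<tau> \<rho> \<sigma> \<phi> by (rule ts.swap_last_two)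
interpretation rt: happy_klein_cocycle G \<rho> \<tau> \<sigma> \<phi> by (rule tr.swap_first_two)

lemma sign_squares:
  "\<phi> \<sigma> \<sigma> \<sigma> * \<phi> \<sigma> \<sigma> \<sigma> = 1" "\<phi> \<tau> \<tau> \<tau> * \<phi> \<tau> \<tau> \<tau> = 1" "\<phi> \<rho> \<rho> \<rho> * \<phi> \<rho> \<rho> \<rho> = 1"
  by (rule sign_square ts.sign_square rs.sign_square)+

lemma outer_pair_values:
  defines "q \<equiv> \<phi> \<sigma> \<tau> \<rho>" and "a \<equiv> \<phi> \<tau> \<sigma> \<sigma>"
  shows "\<phi> \<sigma> \<tau> \<tau> = q * a" "\<phi> \<rho> \<sigma> \<sigma> = \<phi> \<sigma> \<sigma> \<sigma> * a" "\<phi> \<sigma> \<rho> \<rho> = q * \<phi> \<sigma> \<sigma> \<sigma> * a"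
    "\<phi> \<rho> \<tau> \<tau> = q * \<phi> \<tau> \<tau> \<tau> * a" "\<phi> \<tau> \<rho> \<rho> = \<phi> \<tau> \<tau> \<tau> * a"
proof -
  show 1: "\<phi> \<sigma> \<tau> \<tau> = q * a" and 2: "\<phi> \<rho> \<sigma> \<sigma> = \<phi> \<sigma> \<sigma> \<sigma> * a"
    unfolding q_def a_def by (rule swap_outer_pair change_partner)+
  show "\<phi> \<sigma> \<rho> \<rho> = q * \<phi> \<sigma> \<sigma> \<sigma> * a"
    using sr.swap_outer_pair 2 by (simp add: distinct_values q_def ac_simps)
  show 3: "\<phi> \<rho> \<tau> \<tau> = q * \<phi> \<tau> \<tau> \<tau> * a"
    using ts.change_partner 1 by (simp add: ac_simps)
  \<comment> \<open>This path contains two moves of the first kind, hence \<open>q\<^sup>2\<close>.\<close>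
  have "\<phi> \<tau> \<rho> \<rho> = (q * q) * (\<phi> \<tau> \<tau> \<tau> * a)"
    using tr.swap_outer_pair 3 by (simp add: distinct_values q_def ac_simps)
  then show "\<phi> \<tau> \<rho> \<rho> = \<phi> \<tau> \<tau> \<tau> * a"
    by (simp add: q_def distinct_square)
qed

text \<open>
  The last edge of the hexagon joins the pairs \<open>(\<rho>, \<sigma>)\<close> and \<open>(\<rho>, \<tau>)\<close>, already reached from
  \<open>(\<sigma>, \<tau>)\<close> in opposite directions.  Comparing the two results cancels \<open>\<phi> \<tau> \<sigma> \<sigma>\<close> and leaves the
  condition that the hexagon closes up.
\<close>

lemma distinct_value_eq_signs: "\<phi> \<sigma> \<tau> \<rho> = \<phi> \<sigma> \<sigma> \<sigma> * \<phi> \<tau> \<tau> \<tau> * \<phi> \<rho> \<rho> \<rho>"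
proof -
  let ?q = "\<phi> \<sigma> \<tau> \<rho>" and ?s = "\<phi> \<sigma> \<sigma> \<sigma>" and ?t = "\<phi> \<tau> \<tau> \<tau>" and ?r = "\<phi> \<rho> \<rho> \<rho>"
  have "?t * \<phi> \<tau> \<sigma> \<sigma> = ?r * (?q * ?s * \<phi> \<tau> \<sigma> \<sigma>)"
    using rs.change_partner unfolding outer_pair_values .
  then have "?t = ?r * ?q * ?s"
    using nonzero[of \<tau> \<sigma> \<sigma>] by simp
  then have "?s * ?t * ?r = ?q * (?s * ?s) * (?r * ?r)"
    by (simp add: ac_simps)
  then show ?thesis
    by (simp add: sign_squares)
qed

lemma repeated_left_values:
  defines "q \<equiv> \<phi> \<sigma> \<tau> \<rho>" and "a \<equiv> \<phi> \<tau> \<sigma> \<sigma>"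
  shows "\<phi> \<sigma> \<sigma> \<tau> = inverse a" "\<phi> \<tau> \<tau> \<sigma> = q * inverse a"
    "\<phi> \<sigma> \<sigma> \<rho> = \<phi> \<sigma> \<sigma> \<sigma> * inverse a" "\<phi> \<rho> \<rho> \<sigma> = q * \<phi> \<sigma> \<sigma> \<sigma> * inverse a"
    "\<phi> \<tau> \<tau> \<rho> = q * \<phi> \<tau> \<tau> \<tau> * inverse a" "\<phi> \<rho> \<rho> \<tau> = \<phi> \<tau> \<tau> \<tau> * inverse a"
proof -
  have "inverse q = q" "inverse (\<phi> \<sigma> \<sigma> \<sigma>) = \<phi> \<sigma> \<sigma> \<sigma>" "inverse (\<phi> \<tau> \<tau> \<tau>) = \<phi> \<tau> \<tau> \<tau>"
    unfolding q_def by (rule inverse_unique sign_squares distinct_square)+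
  then show "\<phi> \<sigma> \<sigma> \<tau> = inverse a" "\<phi> \<tau> \<tau> \<sigma> = q * inverse a"
    "\<phi> \<sigma> \<sigma> \<rho> = \<phi> \<sigma> \<sigma> \<sigma> * inverse a" "\<phi> \<rho> \<rho> \<sigma> = q * \<phi> \<sigma> \<sigma> \<sigma> * inverse a"
    "\<phi> \<tau> \<tau> \<rho> = q * \<phi> \<tau> \<tau> \<tau> * inverse a" "\<phi> \<rho> \<rho> \<tau> = \<phi> \<tau> \<tau> \<tau> * inverse a"
    using repeated_left ts.repeated_left sr.repeated_left rs.repeated_left tr.repeated_left
      rt.repeated_left
    by (simp_all add: outer_pair_values a_def q_def)
qed

lemma sandwich_values:
  defines "q \<equiv> \<phi> \<sigma> \<tau> \<rho>" and "b \<equiv> \<phi> \<sigma> \<tau> \<sigma>"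
  shows "\<phi> \<tau> \<sigma> \<tau> = q * inverse b" "\<phi> \<sigma> \<rho> \<sigma> = \<phi> \<sigma> \<sigma> \<sigma> * inverse b"
    "\<phi> \<rho> \<sigma> \<rho> = q * \<phi> \<sigma> \<sigma> \<sigma> * b" "\<phi> \<tau> \<rho> \<tau> = q * \<phi> \<tau> \<tau> \<tau> * b"
    "\<phi> \<rho> \<tau> \<rho> = \<phi> \<tau> \<tau> \<tau> * inverse b"
proof -
  have inv: "inverse q = q" "inverse (\<phi> \<sigma> \<sigma> \<sigma>) = \<phi> \<sigma> \<sigma> \<sigma>" "inverse (\<phi> \<tau> \<tau> \<tau>) = \<phi> \<tau> \<tau> \<tau>"
    unfolding q_def by (rule inverse_unique sign_squares distinct_square)+
  show 1: "\<phi> \<tau> \<sigma> \<tau> = q * inverse b" and 2: "\<phi> \<sigma> \<rho> \<sigma> = \<phi> \<sigma> \<sigma> \<sigma> * inverse b"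
    unfolding q_def b_def by (rule swap_sandwich change_sandwich)+
  show "\<phi> \<rho> \<sigma> \<rho> = q * \<phi> \<sigma> \<sigma> \<sigma> * b"
    using sr.swap_sandwich 2 inv by (simp add: distinct_values q_def)
  show 3: "\<phi> \<tau> \<rho> \<tau> = q * \<phi> \<tau> \<tau> \<tau> * b"
    using ts.change_sandwich 1 inv by (simp add: ac_simps)
  have "\<phi> \<rho> \<tau> \<rho> = (q * q) * (\<phi> \<tau> \<tau> \<tau> * inverse b)"
    using tr.swap_sandwich 3 inv by (simp add: distinct_values q_def ac_simps)
  then show "\<phi> \<rho> \<tau> \<rho> = \<phi> \<tau> \<tau> \<tau> * inverse b"
    by (simp add: q_def distinct_square)
qed

lemmas all_values =
  one_entry distinct_values distinct_value_eq_signs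
  outer_pair_values repeated_left_values sandwich_values

end

text \<open>
  Each of the 64 values is \<open>1\<close> (a trivial entry), \<open>q\<close>, one of the five given values, or listed above
  in terms of these; and \<open>q\<close> itself is the product of the given signs.
\<close>

lemma happy_klein_cocycle_unique:
  assumes "happy_klein_cocycle G \<sigma> \<tau> \<rho> \<phi>" "happy_klein_cocycle G \<sigma> \<tau> \<rho> \<psi>"
    and agree: "\<psi> \<sigma> \<sigma> \<sigma> = \<phi> \<sigma> \<sigma> \<sigma>" "\<psi> \<tau> \<tau> \<tau> = \<phi> \<tau> \<tau> \<tau>" "\<psi> \<rho> \<rho> \<rho> = \<phi> \<rho> \<rho> \<rho>"
      "\<psi> \<tau> \<sigma> \<sigma> = \<phi> \<tau> \<sigma> \<sigma>" "\<psi> \<sigma> \<tau> \<sigma> = \<phi> \<sigma> \<tau> \<sigma>"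
    and "x \<in> carrier G" "y \<in> carrier G" "z \<in> carrier G"
  shows "\<psi> x y z = \<phi> x y z"
proof -
  interpret F: happy_klein_cocycle G \<sigma> \<tau> \<rho> \<phi> by fact
  interpret P: happy_klein_cocycle G \<sigma> \<tau> \<rho> \<psi> by fact
  have "x \<in> {\<one>\<^bsub>G\<^esub>, \<sigma>, \<tau>, \<rho>}" "y \<in> {\<one>\<^bsub>G\<^esub>, \<sigma>, \<tau>, \<rho>}" "z \<in> {\<one>\<^bsub>G\<^esub>, \<sigma>, \<tau>, \<rho>}"
    using assms F.carrier_eq by simp_all
  then show ?thesis
    by (elim insertE emptyE; simp add: F.all_values P.all_values agree)
qed

theorem theorem3p5:
  fixes G :: "('g, 'm) monoid_scheme"
    and \<sigma> \<tau> \<rho> :: 'g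
    and \<phi> :: "'g \<Rightarrow> 'g \<Rightarrow> 'g \<Rightarrow> 'k::field"
    and \<epsilon>\<sigma> \<epsilon>\<tau> \<epsilon>\<rho> p a b :: 'k
  assumes char: "CHAR('k) \<noteq> 2"
    and G: "klein_four G \<sigma> \<tau> \<rho>"
    and cocycle: "normalized_three_cocycle G \<phi>"
    and happy: "happy \<sigma> \<tau> \<rho> \<phi>"
    and \<epsilon>\<sigma>: "\<epsilon>\<sigma> = \<phi> \<sigma> \<sigma> \<sigma>"
    and \<epsilon>\<tau>: "\<epsilon>\<tau> = \<phi> \<tau> \<tau> \<tau>"
    and \<epsilon>\<rho>: "\<epsilon>\<rho> = \<phi> \<rho> \<rho> \<rho>"
    and p: "p = \<epsilon>\<sigma> * \<epsilon>\<tau> * \<epsilon>\<rho>"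
    and a: "a = \<phi> \<tau> \<sigma> \<sigma>"
    and b: "b = \<phi> \<sigma> \<tau> \<sigma>"
  shows
    "(\<forall>\<psi> :: 'g \<Rightarrow> 'g \<Rightarrow> 'g \<Rightarrow> 'k.
        normalized_three_cocycle G \<psi> \<and> happy \<sigma> \<tau> \<rho> \<psi> \<and>
        \<psi> \<sigma> \<sigma> \<sigma> = \<epsilon>\<sigma> \<and> \<psi> \<tau> \<tau> \<tau> = \<epsilon>\<tau> \<and> \<psi> \<rho> \<rho> \<rho> = \<epsilon>\<rho> \<and>
        \<psi> \<tau> \<sigma> \<sigma> = a \<and> \<psi> \<sigma> \<tau> \<sigma> = b \<longrightarrow>
        (\<forall>x\<in>carrier G. \<forall>y\<in>carrier G. \<forall>z\<in>carrier G. \<psi> x y z = \<phi> x y z)) \<and>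
     a = \<phi> \<tau> \<sigma> \<sigma> \<and>
     a = p * \<phi> \<sigma> \<tau> \<tau> \<and>
     a = p * inverse (\<phi> \<tau> \<tau> \<sigma>) \<and>
     a = inverse (\<phi> \<sigma> \<sigma> \<tau>) \<and>
     a = \<epsilon>\<sigma> * \<phi> \<rho> \<sigma> \<sigma> \<and>
     a = p * \<epsilon>\<sigma> * \<phi> \<sigma> \<rho> \<rho> \<and>
     a = \<epsilon>\<sigma> * inverse (\<phi> \<sigma> \<sigma> \<rho>) \<and>
     a = p * \<epsilon>\<sigma> * inverse (\<phi> \<rho> \<rho> \<sigma>) \<and>
     a = p * \<epsilon>\<tau> * \<phi> \<rho> \<tau> \<tau> \<and>
     a = \<epsilon>\<tau> * \<phi> \<tau> \<rho> \<rho> \<and>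
     a = p * \<epsilon>\<tau> * inverse (\<phi> \<tau> \<tau> \<rho>) \<and>
     a = \<epsilon>\<tau> * inverse (\<phi> \<rho> \<rho> \<tau>) \<and>
     b = \<phi> \<sigma> \<tau> \<sigma> \<and>
     b = p * \<epsilon>\<sigma> * \<phi> \<rho> \<sigma> \<rho> \<and>
     b = p * \<epsilon>\<tau> * \<phi> \<tau> \<rho> \<tau> \<and>
     b = p * inverse (\<phi> \<tau> \<sigma> \<tau>) \<and>
     b = \<epsilon>\<sigma> * inverse (\<phi> \<sigma> \<rho> \<sigma>) \<and>
     b = \<epsilon>\<tau> * inverse (\<phi> \<rho> \<tau> \<rho>)"
proof (intro conjI)
  interpret happy_klein_cocycle G \<sigma> \<tau> \<rho> \<phi>
    using G cocycle happy by (simp add: happy_klein_cocycle_def happy_klein_cocycle_axioms_def)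
  show "\<forall>\<psi> :: 'g \<Rightarrow> 'g \<Rightarrow> 'g \<Rightarrow> 'k.
      normalized_three_cocycle G \<psi> \<and> happy \<sigma> \<tau> \<rho> \<psi> \<and>
      \<psi> \<sigma> \<sigma> \<sigma> = \<epsilon>\<sigma> \<and> \<psi> \<tau> \<tau> \<tau> = \<epsilon>\<tau> \<and> \<psi> \<rho> \<rho> \<rho> = \<epsilon>\<rho> \<and>
      \<psi> \<tau> \<sigma> \<sigma> = a \<and> \<psi> \<sigma> \<tau> \<sigma> = b \<longrightarrow>
      (\<forall>x\<in>carrier G. \<forall>y\<in>carrier G. \<forall>z\<in>carrier G. \<psi> x y z = \<phi> x y z)"
  proof (intro allI impI ballI, elim conjE)
    fix \<psi> :: "'g \<Rightarrow> 'g \<Rightarrow> 'g \<Rightarrow> 'k" and x y z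
    assume "normalized_three_cocycle G \<psi>" "happy \<sigma> \<tau> \<rho> \<psi>"
      and agree: "\<psi> \<sigma> \<sigma> \<sigma> = \<epsilon>\<sigma>" "\<psi> \<tau> \<tau> \<tau> = \<epsilon>\<tau>" "\<psi> \<rho> \<rho> \<rho> = \<epsilon>\<rho>" "\<psi> \<tau> \<sigma> \<sigma> = a" "\<psi> \<sigma> \<tau> \<sigma> = b"
      and "x \<in> carrier G" "y \<in> carrier G" "z \<in> carrier G"
    moreover from this have "happy_klein_cocycle G \<sigma> \<tau> \<rho> \<psi>"
      using G by (simp add: happy_klein_cocycle_def happy_klein_cocycle_axioms_def)
    ultimately show "\<psi> x y z = \<phi> x y z"
      using happy_klein_cocycle_unique[OF happy_klein_cocycle_axioms, of \<psi> x y z]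
      by (simp add: \<epsilon>\<sigma> \<epsilon>\<tau> \<epsilon>\<rho> a b)
  qed
  have q: "\<phi> \<sigma> \<tau> \<rho> = p"
    by (simp add: distinct_value_eq_signs p \<epsilon>\<sigma> \<epsilon>\<tau> \<epsilon>\<rho>)
  have squares: "p * p = 1" "\<epsilon>\<sigma> * \<epsilon>\<sigma> = 1" "\<epsilon>\<tau> * \<epsilon>\<tau> = 1"
    using distinct_square sign_squares by (simp_all add: q \<epsilon>\<sigma> \<epsilon>\<tau>)
  have self_inverse: "inverse p = p" "inverse \<epsilon>\<sigma> = \<epsilon>\<sigma>" "inverse \<epsilon>\<tau> = \<epsilon>\<tau>"
    by (rule inverse_unique squares)+
  \<comment> \<open>Each value is \<open>a\<close>, \<open>b\<close> or an inverse of these times self-inverse factors, and multiplying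
      by those factors once more cancels them.\<close>
  have cancel: "p * (p * c) = c" "\<epsilon>\<sigma> * (\<epsilon>\<sigma> * c) = c" "\<epsilon>\<tau> * (\<epsilon>\<tau> * c) = c" for c
    by (simp_all add: squares flip: mult.assoc)
  note table = outer_pair_values repeated_left_values sandwich_values
  note table = table[unfolded q, folded \<epsilon>\<sigma> \<epsilon>\<tau> a b]
  show "a = \<phi> \<tau> \<sigma> \<sigma>" "b = \<phi> \<sigma> \<tau> \<sigma>"
    by (rule a b)+
  show "a = p * \<phi> \<sigma> \<tau> \<tau>" "a = p * inverse (\<phi> \<tau> \<tau> \<sigma>)" "a = inverse (\<phi> \<sigma> \<sigma> \<tau>)"
    "a = \<epsilon>\<sigma> * \<phi> \<rho> \<sigma> \<sigma>" "a = p * \<epsilon>\<sigma> * \<phi> \<sigma> \<rho> \<rho>" "a = \<epsilon>\<sigma> * inverse (\<phi> \<sigma> \<sigma> \<rho>)"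
    "a = p * \<epsilon>\<sigma> * inverse (\<phi> \<rho> \<rho> \<sigma>)" "a = p * \<epsilon>\<tau> * \<phi> \<rho> \<tau> \<tau>" "a = \<epsilon>\<tau> * \<phi> \<tau> \<rho> \<rho>"
    "a = p * \<epsilon>\<tau> * inverse (\<phi> \<tau> \<tau> \<rho>)" "a = \<epsilon>\<tau> * inverse (\<phi> \<rho> \<rho> \<tau>)" "b = p * \<epsilon>\<sigma> * \<phi> \<rho> \<sigma> \<rho>"
    "b = p * \<epsilon>\<tau> * \<phi> \<tau> \<rho> \<tau>" "b = p * inverse (\<phi> \<tau> \<sigma> \<tau>)" "b = \<epsilon>\<sigma> * inverse (\<phi> \<sigma> \<rho> \<sigma>)"
    "b = \<epsilon>\<tau> * inverse (\<phi> \<rho> \<tau> \<rho>)"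
    by (simp_all add: table self_inverse cancel mult.assoc mult.left_commute)
qed

end
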